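(* Let $n\ge1$. There are maps $$\star:\mathrm{P}\mathrm{P}[n,\widetilde n]\times\mathrm{P}\mathrm{P}[n,\widetilde n]\to\mathrm{P}\mathrm{P}[n,\widetilde n]\qquad\text{and}\qquad\star:\mathrm{P}\mathrm{P}[n,\widetilde n]\times\mathrm{P}\mathrm{P}[n]\to\mathrm{P}\mathrm{P}[n],$$ turning $\mathrm{P}\mathrm{P}[n,\widetilde n]$ into a $\mathbb{Z}_2$-algebra and $\mathrm{P}\mathrm{P}[n]$ into a module over $\mathrm{P}\mathrm{P}[n,\widetilde n]$, such that the pair $(\mathrm{P}\mathrm{P}[n,\widetilde n],\mathrm{P}\mathrm{P}[n])$ is isomorphic to $\left(\mathrm{End}_{\mathbb{Z}_2}(\mathrm{M}(\mathbb{Z}_2^n,\mathbb{Z}_2)),\mathrm{M}(\mathbb{Z}_2^n,\mathbb{Z}_2)\right)$ via the maps $$A\mapsto\sum_{a\in A}m^{a_1}s^{a_2}\qquad\text{and}\qquad F\mapsto\sum_{a\in F}m^a.$$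
   Context: $\mathbb{Z}_2=\{0,1\}$ is the field with two elements, $[n]=\{1,\dots,n\}$, $\mathrm{P}(y)$ is the set of subsets of $y$, and $\mathrm{P}\mathrm{P}(y)=\mathrm{P}(\mathrm{P}(y))$. $[n,\widetilde n]=\{1,\dots,n,\widetilde1,\dots,\widetilde n\}$ is the disjoint union of two copies of $[n]$; for $a\subseteq[n]$, $\widetilde a=\{\widetilde i\mid i\in a\}$. Each $a\in\mathrm{P}[n,\widetilde n]$ is written uniquely as $a=a_1\sqcup\widetilde a_2$ with $a_1,a_2\in\mathrm{P}[n]$. The additive structure on $\mathrm{P}\mathrm{P}[n,\widetilde n]$ and on $\mathrm{P}\mathrm{P}[n]$ is the symmetric difference $A+B=(A\cup B)\setminus(A\cap B)$. $\mathrm{M}(\mathbb{Z}_2^n,\mathbb{Z}_2)$ is the $\mathbb{Z}_2$-algebra of all maps $\mathbb{Z}_2^n\to\mathbb{Z}_2$; it is a module over its algebra of $\mathbb{Z}_2$-linear endomorphisms $\mathrm{End}_{\mathbb{Z}_2}(\mathrm{M}(\mathbb{Z}_2^n,\mathbb{Z}_2))$ by evaluation. Identify $\mathrm{P}[n]$ with $\mathbb{Z}_2^n$ via indicator vectors. For $a\in\mathrm{P}[n]$, $m^a$ is the function with $m^a(b)=1$ if $b=a$ and $0$ otherwise, also viewed as the operator of multiplication by it; $s^a=\prod_{i\in a}s_i$ where $s_if(x)=f(x+e_i)$ is the shift operator and $e_i$ is the vector whose only nonzero entry is at position $i$. Pairs $(A,M)$ consist of a $\mathbb{Z}_2$-algebra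 $A$ and an $A$-module $M$; a morphism $(f,g):(A_1,M_1)\to(A_2,M_2)$ consists of $\mathbb{Z}_2$-linear maps $f:A_1\to A_2$, $g:M_1\to M_2$ with $f$ an algebra morphism and $g(am)=f(a)g(m)$. *)

theory Defs
  imports
    "HOL-Analysis.Finite_Cartesian_Product"
    "HOL-Algebra.Algebraic_Closure_Type"
    "HOL-Library.Function_Algebras"
    "HOL-Library.Z2"
begin

text \<open>
  The index set \<open>[n]\<close>, \<open>n \<ge> 1\<close>, is an arbitrary finite type \<open>'n\<close> with \<open>CARD('n) = n\<close>, and
  \<open>[n, n~]\<close> is \<open>'n + 'n\<close>. So \<open>PP[n]\<close> and \<open>PP[n, n~]\<close> are all of \<open>'n set set\<close> and
  \<open>('n + 'n) set set\<close>, and \<open>Z2^n\<close> is \<open>bit ^ 'n\<close>.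
\<close>


section \<open>Algebras, modules over them, and morphisms of pairs\<close>

text \<open>
  \<^locale>\<open>algebra\<close> of \<^theory>\<open>HOL-Algebra.Module\<close> requires a commutative multiplication, and
  \<^locale>\<open>module\<close> requires a commutative ring of scalars. Neither may be assumed of \<open>A\<close> here.
\<close>

locale assoc_algebra = module R A + A?: ring A for R (structure) and A (structure) +
  assumes smult_mult_left:
      "\<lbrakk>r \<in> carrier R; x \<in> carrier A; y \<in> carrier A\<rbrakk> \<Longrightarrow>
        (r \<odot>\<^bsub>A\<^esub> x) \<otimes>\<^bsub>A\<^esub> y = r \<odot>\<^bsub>A\<^esub> (x \<otimes>\<^bsub>A\<^esub> y)"
    and smult_mult_right:
      "\<lbrakk>r \<in> carrier R; x \<in> carrier A; y \<in> carrier A\<rbrakk> \<Longrightarrow>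
        x \<otimes>\<^bsub>A\<^esub> (r \<odot>\<^bsub>A\<^esub> y) = r \<odot>\<^bsub>A\<^esub> (x \<otimes>\<^bsub>A\<^esub> y)"

text \<open>
  A pair \<open>(A, M)\<close>: the record \<open>M\<close> carries the \<open>R\<close>-linear structure of the module, and
  \<open>act\<close> is the action of \<open>A\<close> on it.
\<close>

locale algebra_module_pair = assoc_algebra R A + M: module R M
  for R :: "('r, 's) ring_scheme" (structure) and A :: "('r, 'a, 't) module_scheme" (structure)
    and M :: "('r, 'm, 'u) module_scheme" +
  fixes act :: "'a \<Rightarrow> 'm \<Rightarrow> 'm"
  assumes act_closed:
      "\<lbrakk>x \<in> carrier A; v \<in> carrier M\<rbrakk> \<Longrightarrow> act x v \<in> carrier M"
    and act_add_left:
      "\<lbrakk>x \<in> carrier A; y \<in> carrier A; v \<in> carrier M\<rbrakk> \<Longrightarrow>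
        act (x \<oplus>\<^bsub>A\<^esub> y) v = act x v \<oplus>\<^bsub>M\<^esub> act y v"
    and act_add_right:
      "\<lbrakk>x \<in> carrier A; v \<in> carrier M; w \<in> carrier M\<rbrakk> \<Longrightarrow>
        act x (v \<oplus>\<^bsub>M\<^esub> w) = act x v \<oplus>\<^bsub>M\<^esub> act x w"
    and act_smult_left:
      "\<lbrakk>r \<in> carrier R; x \<in> carrier A; v \<in> carrier M\<rbrakk> \<Longrightarrow>
        act (r \<odot>\<^bsub>A\<^esub> x) v = r \<odot>\<^bsub>M\<^esub> act x v"
    and act_smult_right:
      "\<lbrakk>r \<in> carrier R; x \<in> carrier A; v \<in> carrier M\<rbrakk> \<Longrightarrow>
        act x (r \<odot>\<^bsub>M\<^esub> v) = r \<odot>\<^bsub>M\<^esub> act x v"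
    and act_mult:
      "\<lbrakk>x \<in> carrier A; y \<in> carrier A; v \<in> carrier M\<rbrakk> \<Longrightarrow>
        act (x \<otimes>\<^bsub>A\<^esub> y) v = act x (act y v)"
    and act_one:
      "v \<in> carrier M \<Longrightarrow> act \<one>\<^bsub>A\<^esub> v = v"

definition lin_hom ::
    "('r, 's) ring_scheme \<Rightarrow> ('r, 'a, 'c) module_scheme \<Rightarrow> ('r, 'b, 'd) module_scheme \<Rightarrow> ('a \<Rightarrow> 'b) set"
  where "lin_hom R M N =
    {h \<in> carrier M \<rightarrow> carrier N.
       (\<forall>x\<in>carrier M. \<forall>y\<in>carrier M. h (x \<oplus>\<^bsub>M\<^esub> y) = h x \<oplus>\<^bsub>N\<^esub> h y) \<and>
       (\<forall>r\<in>carrier R. \<forall>x\<in>carrier M. h (r \<odot>\<^bsub>M\<^esub> x) = r \<odot>\<^bsub>N\<^esub> h x)}"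

locale pair_hom =
  P1: algebra_module_pair R A1 M1 act1 + P2: algebra_module_pair R A2 M2 act2
  for R and A1 and M1 and act1 and A2 and M2 and act2 +
  fixes f g
  assumes f_ring_hom: "f \<in> ring_hom A1 A2"
    and f_lin: "f \<in> lin_hom R A1 A2"
    and g_lin: "g \<in> lin_hom R M1 M2"
    and act_compat: "\<lbrakk>x \<in> carrier A1; v \<in> carrier M1\<rbrakk> \<Longrightarrow> g (act1 x v) = act2 (f x) (g v)"

locale pair_iso = pair_hom +
  assumes f_bij: "bij_betw f (carrier A1) (carrier A2)"
    and g_bij: "bij_betw g (carrier M1) (carrier M2)"


section \<open>Boolean functions and their linear endomorphisms\<close>

abbreviation Z2 :: "bit ring"
  where "Z2 \<equiv> ring_of_type_algebra"

type_synonym 'n boolfun = "bit ^ 'n \<Rightarrow> bit"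

text \<open>In \<^theory>\<open>HOL-Library.Function_Algebras\<close> the operations \<open>+\<close>, \<open>*\<close>, \<open>0\<close>, \<open>1\<close> on functions
  are pointwise; this also gives \<open>+\<close>, \<open>0\<close> and finite sums of operators, whose product is
  \<open>\<circ>\<close> and not \<open>*\<close>.\<close>

definition boolfun_algebra :: "(bit, 'n::finite boolfun) module"
  where "boolfun_algebra =
    \<lparr>carrier = UNIV, monoid.mult = (*), one = 1, zero = 0, add = (+), module.smult = (\<lambda>c f x. c * f x)\<rparr>"

definition End_algebra :: "(bit, 'n::finite boolfun \<Rightarrow> 'n boolfun) module"
  where "End_algebra =
    \<lparr>carrier = lin_hom Z2 boolfun_algebra boolfun_algebra,
     monoid.mult = (\<circ>), one = id, zero = 0, add = (+), module.smult = (\<lambda>c T f x. c * T f x)\<rparr>"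

definition indicator_vec :: "'n::finite set \<Rightarrow> bit ^ 'n"
  where "indicator_vec a = (\<chi> i. if i \<in> a then 1 else 0)"

definition m_fun :: "'n::finite set \<Rightarrow> 'n boolfun"
  where "m_fun a = (\<lambda>x. if x = indicator_vec a then 1 else 0)"

definition m_op :: "'n::finite set \<Rightarrow> 'n boolfun \<Rightarrow> 'n boolfun"
  where "m_op a = (\<lambda>f. m_fun a * f)"

definition shift :: "'n::finite \<Rightarrow> 'n boolfun \<Rightarrow> 'n boolfun"
  where "shift i f = (\<lambda>x. f (x + axis i 1))"

text \<open>The product of the \<open>shift i\<close> for \<open>i \<in> a\<close>; these commute, so the order does not matter.\<close>

definition s_op :: "'n::finite set \<Rightarrow> 'n boolfun \<Rightarrow> 'n boolfun"
  where "s_op a = Finite_Set.fold (\<lambda>i T. shift i \<circ> T) id a"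

lemma comp_fun_commute_shift: "comp_fun_commute (\<lambda>i T. shift i \<circ> T)"
  by unfold_locales (simp add: fun_eq_iff shift_def ac_simps)

lemma s_op_empty: "s_op {} = id"
  by (simp add: s_op_def)

lemma s_op_insert: "i \<notin> a \<Longrightarrow> s_op (insert i a) = shift i \<circ> s_op a"
  unfolding s_op_def
  by (rule comp_fun_commute_on.fold_insert[OF comp_fun_commute_shift[unfolded comp_fun_commute_def']])
     auto


section \<open>Sets of subsets\<close>

text \<open>The vector space of sets of elements of \<open>'a\<close> under symmetric difference, equipped with
  a multiplication \<open>star\<close> and an intended unit \<open>e\<close>.\<close>

definition symdiff_algebra :: "('a set \<Rightarrow> 'a set \<Rightarrow> 'a set) \<Rightarrow> 'a set \<Rightarrow> (bit, 'a set) module"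
  where "symdiff_algebra star e =
    \<lparr>carrier = UNIV, monoid.mult = star, one = e, zero = {},
     add = (\<lambda>A B. (A \<union> B) - (A \<inter> B)), module.smult = (\<lambda>c A. if c = 1 then A else {})\<rparr>"

text \<open>Only the linear structure is relevant here: the locale \<^locale>\<open>module\<close> imposes nothing on the
  fields \<open>mult\<close> and \<open>one\<close>, which are filled with intersection and its unit.\<close>

definition symdiff_space :: "(bit, 'a set) module"
  where "symdiff_space = symdiff_algebra (\<inter>) UNIV"

text \<open>The parts \<open>a1\<close>, \<open>a2\<close> of \<open>a\<close> are its preimages under the two injections.\<close>

definition op_of :: "('n::finite + 'n) set set \<Rightarrow> 'n boolfun \<Rightarrow> 'n boolfun"
  where "op_of A = (\<Sum>a\<in>A. m_op (Inl -` a) \<circ> s_op (Inr -` a))"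

definition fun_of :: "'n::finite set set \<Rightarrow> 'n boolfun"
  where "fun_of F = (\<Sum>a\<in>F. m_fun a)"

end

theory Submission
  imports Defs
begin

text \<open>
  The functions \<open>m\<^sup>c\<close> are the indicator functions of the points of \<open>Z2\<^sup>n\<close>, hence a basis of the
  space of Boolean functions, and \<^const>\<open>fun_of\<close> reads a set of subsets as the coordinate vector
  of a function in this basis (\<open>bij_fun_of\<close>). With respect to the same basis, the operator
  \<open>m\<^sup>b s\<^sup>d\<close> is a matrix unit: evaluated at the point \<open>b\<close> it reads off the value of its argument at
  \<open>b + d\<close>, and it vanishes at all other points. So its only nonzero entry is in row \<open>b\<close> and
  column \<open>b + d\<close>, where the sum is the symmetric difference. As \<open>(b, d)\<close> runs through all pairs of
  subsets, so does \<open>(b, b + d)\<close>; every matrix position is hit exactly once. Hence the operators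
  \<open>m\<^sup>b s\<^sup>d\<close> are a basis of all linear endomorphisms, and \<^const>\<open>op_of\<close> is bijective
  (\<open>op_of_matrix_entry\<close> and \<open>bij_op_of\<close>).

  Over the field with two elements, a finite sum over a set depends additively on the set, where
  sets are added by symmetric difference (\<open>sum_sym_diff\<close>). Both maps are therefore linear
  bijections, and the product, the unit and the action of the endomorphism algebra can be pulled
  back along them (\<open>symdiff_pair_iso_transport\<close>). The pulled-back operations satisfy the laws of an
  algebra and of a module because the original ones do.
\<close>

text \<open>
  The arithmetic of \<^typ>\<open>bit\<close> is kept as that of a field; by default the simplifier would turn
  its sums and products into bitwise operations.
\<close>

declare add_bit_eq_xor [simp del] mult_bit_eq_and [simp del]


section \<open>Transport of structure to sets under symmetric difference\<close>

lemma cring_Z2: "cring Z2"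
  by (rule cring_from_type_algebra)

lemma symdiff_algebra_simps [simp]:
  "carrier (symdiff_algebra star e) = UNIV"
  "monoid.mult (symdiff_algebra star e) = star"
  "monoid.one (symdiff_algebra star e) = e"
  "ring.zero (symdiff_algebra star e) = {}"
  "ring.add (symdiff_algebra star e) A B = (A \<union> B) - (A \<inter> B)"
  "module.smult (symdiff_algebra star e) c A = (if c = 1 then A else {})"
  by (simp_all add: symdiff_algebra_def)

lemma Z2_simps [simp]:
  "carrier Z2 = UNIV" "monoid.mult Z2 = (*)" "monoid.one Z2 = 1" "ring.zero Z2 = 0" "ring.add Z2 = (+)"
  by (simp_all only: ring_of_type_algebra_def partial_object.simps monoid.simps ring.simps)

lemma module_symdiff: "module Z2 (symdiff_algebra star e)"
proof (rule moduleI)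
  show "abelian_group (symdiff_algebra star e)"
    by (rule abelian_groupI) auto
next
  fix a b :: bit and A
  show "(a \<oplus>\<^bsub>Z2\<^esub> b) \<odot>\<^bsub>symdiff_algebra star e\<^esub> A
      = a \<odot>\<^bsub>symdiff_algebra star e\<^esub> A \<oplus>\<^bsub>symdiff_algebra star e\<^esub> b \<odot>\<^bsub>symdiff_algebra star e\<^esub> A"
    by (cases a; cases b) auto
qed (auto simp: cring_Z2)

lemma module_symdiff_space: "module Z2 symdiff_space"
  unfolding symdiff_space_def by (rule module_symdiff)

lemma symdiff_space_simps [simp]:
  "carrier symdiff_space = UNIV"
  "ring.zero symdiff_space = {}"
  "ring.add symdiff_space A B = (A \<union> B) - (A \<inter> B)"
  "module.smult symdiff_space c A = (if c = 1 then A else {})"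
  by (simp_all add: symdiff_space_def)

text \<open>
  The only scalars are 0 and 1, so an additive map is already linear; it is enough to know that it
  sends the empty set to zero, which is the case because the empty set is its own double.
\<close>

lemma symdiff_additive_smult:
  assumes "module Z2 N"
    and closed: "\<And>A. f A \<in> carrier N"
    and add: "\<And>A B. f ((A \<union> B) - (A \<inter> B)) = f A \<oplus>\<^bsub>N\<^esub> f B"
  shows "f (if c = 1 then A else {}) = c \<odot>\<^bsub>N\<^esub> f A"
proof -
  interpret N: module Z2 N by fact
  have "f {} \<oplus>\<^bsub>N\<^esub> f {} = f {}"
    using add[of "{}" "{}"] by simp
  then have "f {} = \<zero>\<^bsub>N\<^esub>"
    using closed N.add.r_cancel_one' by metis
  then show ?thesis
    using N.smult_l_null[OF closed] N.smult_one[OF closed] by (cases c) simp_all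
qed

text \<open>
  Transport of structure. The linear structures on both sides are given and respected by the two
  bijections, so that only the product, the unit and the action have to be defined. Each law for
  these is an equation between sets, which by injectivity may be checked after applying the
  bijection, where it becomes the corresponding law of the given pair.
\<close>

lemma symdiff_pair_iso_transport:
  fixes E :: "(bit, 'e, 't) module_scheme" and N :: "(bit, 'v, 'u) module_scheme"
    and f :: "'a set \<Rightarrow> 'e" and g :: "'b set \<Rightarrow> 'v"
  assumes pair: "algebra_module_pair Z2 E N act"
    and f_bij: "bij_betw f UNIV (carrier E)"
    and f_add: "\<And>A B. f ((A \<union> B) - (A \<inter> B)) = f A \<oplus>\<^bsub>E\<^esub> f B"
    and g_bij: "bij_betw g UNIV (carrier N)"
    and g_add: "\<And>F G. g ((F \<union> G) - (F \<inter> G)) = g F \<oplus>\<^bsub>N\<^esub> g G"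
  obtains star :: "'a set \<Rightarrow> 'a set \<Rightarrow> 'a set" and act' :: "'a set \<Rightarrow> 'b set \<Rightarrow> 'b set" and e
  where "pair_iso Z2 (symdiff_algebra star e) symdiff_space act' E N act f g"
proof -
  interpret E: algebra_module_pair Z2 E N act by fact
  have f_in: "f A \<in> carrier E" for A using f_bij by (auto simp: bij_betw_def)
  have g_in: "g F \<in> carrier N" for F using g_bij by (auto simp: bij_betw_def)
  have f_inj: "f A = f B \<longleftrightarrow> A = B" for A B
    using f_bij by (auto simp: bij_betw_def inj_on_def)
  have g_inj: "g F = g G \<longleftrightarrow> F = G" for F G
    using g_bij by (auto simp: bij_betw_def inj_on_def)
  define star where "star A B = inv_into UNIV f (f A \<otimes>\<^bsub>E\<^esub> f B)" for A B
  define e where "e = inv_into UNIV f \<one>\<^bsub>E\<^esub>"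
  define act' where "act' A F = inv_into UNIV g (act (f A) (g F))" for A F
  have f_star: "f (star A B) = f A \<otimes>\<^bsub>E\<^esub> f B" for A B
    unfolding star_def by (rule bij_betw_inv_into_right[OF f_bij]) (simp add: f_in)
  have f_e: "f e = \<one>\<^bsub>E\<^esub>"
    unfolding e_def by (rule bij_betw_inv_into_right[OF f_bij]) simp
  have g_act: "g (act' A F) = act (f A) (g F)" for A F
    unfolding act'_def by (rule bij_betw_inv_into_right[OF g_bij]) (simp add: f_in g_in E.act_closed)
  have f_smult: "f (if c = 1 then A else {}) = c \<odot>\<^bsub>E\<^esub> f A" for c A
    by (rule symdiff_additive_smult[where f = f, OF E.module_axioms f_in f_add])
  have g_smult: "g (if c = 1 then F else {}) = c \<odot>\<^bsub>N\<^esub> g F" for c F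
    by (rule symdiff_additive_smult[where f = g, OF E.M.module_axioms g_in g_add])
  let ?S = "symdiff_algebra star e"
  interpret S: module Z2 ?S by (rule module_symdiff)
  have monoid: "Group.monoid ?S"
    by (rule monoidI)
      (simp_all add: f_star f_e f_in E.A.m_assoc flip: f_inj)
  have "ring ?S"
    by (rule ringI[OF S.abelian_group_axioms monoid])
      (simp_all add: f_star f_add f_in E.A.l_distr E.A.r_distr flip: f_inj)
  then have alg: "assoc_algebra Z2 ?S"
    by (intro assoc_algebra.intro assoc_algebra_axioms.intro S.module_axioms)
      (simp_all only: symdiff_algebra_simps,
       simp_all add: f_star f_smult f_in E.smult_mult_left E.smult_mult_right split del: if_split flip: f_inj)
  have "algebra_module_pair_axioms Z2 ?S symdiff_space act'"
    by (rule algebra_module_pair_axioms.intro)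
      (simp_all only: symdiff_algebra_simps symdiff_space_simps UNIV_I flip: g_inj,
       simp_all add: g_act f_in g_in f_add g_add f_smult g_smult f_star f_e
         E.act_add_left E.act_add_right E.act_smult_left E.act_smult_right E.act_mult E.act_one
         split del: if_split)
  then have P: "algebra_module_pair Z2 ?S symdiff_space act'"
    by (intro algebra_module_pair.intro alg module_symdiff_space)
  have "pair_iso Z2 ?S symdiff_space act' E N act f g"
    by (intro pair_iso.intro pair_hom.intro P pair pair_hom_axioms.intro pair_iso_axioms.intro)
      (auto simp: ring_hom_def lin_hom_def f_in g_in f_star f_add f_e f_smult g_add g_smult g_act
         f_bij g_bij split del: if_split)
  then show ?thesis by (rule that)
qed

section \<open>Boolean functions and their endomorphisms as a pair\<close>

lemma boolfun_add_self [simp]: "f + f = (0 :: 'n::finite boolfun)"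
proof
  fix x
  show "(f + f) x = 0 x"
    by (cases "f x") simp_all
qed

lemma boolfun_algebra_simps [simp]:
  "carrier boolfun_algebra = UNIV"
  "ring.zero boolfun_algebra = 0"
  "ring.add boolfun_algebra = (+)"
  "module.smult boolfun_algebra c f = (\<lambda>x. c * f x)"
  by (simp_all add: boolfun_algebra_def)

lemma additive_boolfun_smult:
  fixes T :: "'n::finite boolfun \<Rightarrow> 'n boolfun"
  assumes add: "\<And>f g. T (f + g) = T f + T g"
  shows "T (\<lambda>x. c * f x) = (\<lambda>x. c * T f x)"
proof -
  have "T 0 = 0"
    using add[of 0 0] by simp
  then show ?thesis
    by (cases c) (simp_all add: zero_fun_def)
qed

lemma lin_hom_boolfun_iff:
  fixes T :: "'n::finite boolfun \<Rightarrow> 'n boolfun"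
  shows "T \<in> lin_hom Z2 boolfun_algebra boolfun_algebra \<longleftrightarrow> (\<forall>f g. T (f + g) = T f + T g)"
proof
  assume "\<forall>f g. T (f + g) = T f + T g"
  then show "T \<in> lin_hom Z2 boolfun_algebra boolfun_algebra"
    using additive_boolfun_smult[of T] by (simp add: lin_hom_def)
qed (simp add: lin_hom_def)

lemma End_algebra_simps [simp]:
  "carrier End_algebra = {T. \<forall>f g. T (f + g) = T f + T g}"
  "monoid.mult End_algebra = (\<circ>)"
  "monoid.one End_algebra = id"
  "ring.zero End_algebra = 0"
  "ring.add End_algebra = (+)"
  "module.smult End_algebra c T = (\<lambda>f x. c * T f x)"
  by (auto simp add: End_algebra_def lin_hom_boolfun_iff)

lemma module_boolfun: "module Z2 boolfun_algebra"
proof (rule moduleI[OF cring_Z2])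
  show "abelian_group boolfun_algebra"
    by (rule abelian_groupI) (auto simp: add_ac intro: boolfun_add_self)
qed (auto simp: fun_eq_iff algebra_simps)

lemma End_pair: "algebra_module_pair Z2 End_algebra boolfun_algebra (\<lambda>T f. T f)"
proof -
  have grp: "abelian_group End_algebra"
  proof (rule abelian_groupI)
    fix T :: "'n::finite boolfun \<Rightarrow> 'n boolfun"
    assume "T \<in> carrier End_algebra"
    then show "\<exists>S\<in>carrier End_algebra. S \<oplus>\<^bsub>End_algebra\<^esub> T = \<zero>\<^bsub>End_algebra\<^esub>"
      by (intro bexI[of _ T]) (auto simp: fun_eq_iff)
  qed (auto simp: add_ac)
  have "Group.monoid End_algebra"
    by (rule monoidI) (simp_all add: comp_assoc)
  then have "ring End_algebra"
    by (intro ringI grp) (simp_all add: fun_eq_iff)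
  moreover have "module Z2 End_algebra"
    by (rule moduleI[OF cring_Z2 grp]) (simp_all add: fun_eq_iff algebra_simps)
  ultimately have "assoc_algebra Z2 End_algebra"
    by (intro assoc_algebra.intro assoc_algebra_axioms.intro)
      (simp_all add: fun_eq_iff additive_boolfun_smult[unfolded fun_eq_iff])
  then show ?thesis
    by (intro algebra_module_pair.intro module_boolfun algebra_module_pair_axioms.intro)
      (simp_all add: additive_boolfun_smult)
qed

section \<open>Coordinates of functions and operators\<close>

text \<open>
  The terms over the intersection occur twice on the right-hand side and cancel.
\<close>

lemma sum_sym_diff:
  fixes h :: "'a \<Rightarrow> 'b::comm_monoid_add"
  assumes "finite A" "finite B" and self: "\<And>y :: 'b. y + y = 0"
  shows "sum h ((A \<union> B) - (A \<inter> B)) = sum h A + sum h B"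
proof -
  have "sum h A = sum h (A - B) + sum h (A \<inter> B)"
    using assms by (subst sum.union_disjoint[symmetric]) (auto intro: sum.cong)
  moreover have "sum h B = sum h (B - A) + sum h (A \<inter> B)"
    using assms by (subst sum.union_disjoint[symmetric]) (auto intro: sum.cong)
  moreover have "sum h ((A \<union> B) - (A \<inter> B)) = sum h (A - B) + sum h (B - A)"
    using assms by (subst sum.union_disjoint[symmetric]) (auto intro: sum.cong)
  moreover have "(x + z) + (y + z) = x + y" for x y z :: 'b
    using self[of z] by (metis add.assoc add.commute add.right_neutral)
  ultimately show ?thesis by simp
qed

lemma sum_fun_apply: "(\<Sum>a\<in>A. h a) x = (\<Sum>a\<in>A. h a x)"
  by (induction A rule: infinite_finite_induct) simp_all

lemma indicator_vec_eq_iff [simp]: "indicator_vec a = indicator_vec b \<longleftrightarrow> a = b"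
  by (auto simp: indicator_vec_def vec_eq_iff split: if_splits)

lemma indicator_vec_surj: obtains a where "x = indicator_vec a"
proof
  show "x = indicator_vec {i. vec_nth x i = 1}"
    by (auto simp: indicator_vec_def vec_eq_iff)
qed

lemma indicator_vec_add:
  "indicator_vec a + indicator_vec b = indicator_vec ((a \<union> b) - (a \<inter> b))"
  by (auto simp: indicator_vec_def vec_eq_iff)

text \<open>
  Shifting successively by the unit vectors \<open>e\<^sub>i\<close> with \<open>i\<close> in \<open>a\<close> is one shift by their sum, which
  is the indicator vector of \<open>a\<close>.
\<close>

lemma s_op_apply:
  fixes f :: "'n::finite boolfun"
  shows "s_op a f x = f (x + indicator_vec a)"
proof -
  have "finite a" by simp
  then show ?thesis
  proof (induction a arbitrary: x)
    case empty
    have "indicator_vec {} = (0 :: bit ^ 'n)"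
      by (simp add: indicator_vec_def vec_eq_iff)
    then show ?case by (simp add: s_op_empty)
  next
    case (insert i a)
    then have "indicator_vec (insert i a) = axis i 1 + indicator_vec a"
      by (auto simp: indicator_vec_def vec_eq_iff axis_def)
    then show ?case
      using insert by (simp add: s_op_insert shift_def add.assoc)
  qed
qed

lemma fun_of_apply: "fun_of F (indicator_vec b) = of_bool (b \<in> F)"
  by (simp add: fun_of_def sum_fun_apply m_fun_def of_bool_def)

lemma bij_fun_of: "bij (fun_of :: 'n::finite set set \<Rightarrow> 'n boolfun)"
proof (rule bijI)
  show "inj (fun_of :: 'n set set \<Rightarrow> 'n boolfun)"
  proof (rule injI)
    fix F G :: "'n set set"
    assume "fun_of F = fun_of G"
    then have "b \<in> F \<longleftrightarrow> b \<in> G" for b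
      by (metis fun_of_apply of_bool_eq_iff)
    then show "F = G" by auto
  qed
  have "f = fun_of {b. f (indicator_vec b) = 1}" for f :: "'n boolfun"
  proof
    fix x :: "bit ^ 'n"
    obtain b where "x = indicator_vec b" by (rule indicator_vec_surj)
    then show "f x = fun_of {b. f (indicator_vec b) = 1} x"
      by (auto simp: fun_of_apply of_bool_def)
  qed
  then show "surj (fun_of :: 'n set set \<Rightarrow> 'n boolfun)" unfolding surj_def by (intro allI exI)
qed

text \<open>
  The subset \<open>a\<close> for which \<open>m\<^bsup>a1\<^esup> s\<^bsup>a2\<^esup>\<close> is the matrix unit with its nonzero entry in row \<open>b\<close> and
  column \<open>c\<close>: the first part is \<open>b\<close>, and the shift has to carry \<open>b\<close> to \<open>c\<close>, so it is by the
  symmetric difference of \<open>b\<close> and \<open>c\<close>.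
\<close>

definition entry_index :: "'n set \<Rightarrow> 'n set \<Rightarrow> ('n + 'n) set"
  where "entry_index b c = Inl ` b \<union> Inr ` ((b \<union> c) - (b \<inter> c))"

text \<open>
  Adding \<open>b\<close> is an involution for the symmetric difference, so the equation for the second part can
  be solved for \<open>c\<close>. This makes \<^const>\<open>entry_index\<close> a bijection from pairs of subsets.
\<close>

lemma eq_entry_index_iff:
  "a = entry_index b c \<longleftrightarrow> Inl -` a = b \<and> (b \<union> Inr -` a) - (b \<inter> Inr -` a) = c"
proof -
  have "a = entry_index b c \<longleftrightarrow> Inl -` a = b \<and> Inr -` a = (b \<union> c) - (b \<inter> c)"
    by (auto simp: entry_index_def set_eq_iff image_iff split_sum_all)
  also have "Inr -` a = (b \<union> c) - (b \<inter> c) \<longleftrightarrow> (b \<union> Inr -` a) - (b \<inter> Inr -` a) = c"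
  proof -
    have "(x \<in> d \<longleftrightarrow> x \<in> (b \<union> c) - (b \<inter> c)) \<longleftrightarrow> (x \<in> (b \<union> d) - (b \<inter> d) \<longleftrightarrow> x \<in> c)" for x d
      by auto
    then show ?thesis unfolding set_eq_iff by (simp only:)
  qed
  finally show ?thesis .
qed

lemma entry_index_surj: obtains b c where "a = entry_index b c"
proof
  show "a = entry_index (Inl -` a) ((Inl -` a \<union> Inr -` a) - (Inl -` a \<inter> Inr -` a))"
    by (simp add: eq_entry_index_iff)
qed

lemma entry_index_inject: "entry_index b c = entry_index b' c' \<longleftrightarrow> b = b' \<and> c = c'"
  by (metis eq_entry_index_iff)

text \<open>
  Only one summand of \<^term>\<open>op_of A\<close> can contribute to a given matrix entry, so the entries of
  this matrix are the values of the membership predicate of \<open>A\<close>.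
\<close>

lemma op_of_matrix_entry:
  fixes A :: "('n::finite + 'n) set set"
  shows "op_of A (m_fun c) (indicator_vec b) = of_bool (entry_index b c \<in> A)"
proof -
  have "(m_op (Inl -` a) \<circ> s_op (Inr -` a)) (m_fun c) (indicator_vec b)
      = (if a = entry_index b c then 1 else 0)" for a :: "('n + 'n) set"
    unfolding eq_entry_index_iff by (auto simp: m_op_def m_fun_def s_op_apply indicator_vec_add)
  then show ?thesis
    by (simp add: op_of_def sum_fun_apply of_bool_def)
qed

lemma op_of_additive: "op_of A (f + g) = op_of A f + op_of A g"
proof -
  have "(m_op b \<circ> s_op c) (f + g) = (m_op b \<circ> s_op c) f + (m_op b \<circ> s_op c) g" for b c
    by (simp add: m_op_def s_op_apply fun_eq_iff algebra_simps)
  then show ?thesis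
    by (simp add: op_of_def sum_fun_apply sum.distrib)
qed

text \<open>
  An additive operator is determined by its matrix, because every Boolean function is a sum of
  indicator functions of points.
\<close>

lemma additive_eq_on_m_fun:
  fixes T U :: "'n::finite boolfun \<Rightarrow> 'n boolfun"
  assumes T: "\<And>f g. T (f + g) = T f + T g" and U: "\<And>f g. U (f + g) = U f + U g"
    and eq: "\<And>c b. T (m_fun c) (indicator_vec b) = U (m_fun c) (indicator_vec b)"
  shows "T = U"
proof
  fix f
  have eq': "T (m_fun c) = U (m_fun c)" for c
    by (metis eq ext indicator_vec_surj)
  have T0: "T 0 = 0" and U0: "U 0 = 0"
    using T[of 0 0] U[of 0 0] by simp_all
  obtain F :: "'n set set" where "f = fun_of F"
    using bij_fun_of by (metis bij_pointE)
  moreover have "T (\<Sum>a\<in>F. m_fun a) = U (\<Sum>a\<in>F. m_fun a)"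
    using finite[of F] by induction (simp_all only: sum.empty sum.insert not_False_eq_True T U T0 U0 eq')
  ultimately show "T f = U f" by (simp add: fun_of_def)
qed

lemma bij_op_of:
  "bij_betw op_of UNIV (carrier (End_algebra :: (bit, 'n::finite boolfun \<Rightarrow> 'n boolfun) module))"
proof (rule bij_betwI')
  fix A B :: "('n + 'n) set set"
  have "A = B" if eq: "op_of A = op_of B"
  proof (rule Set.set_eqI)
    fix a :: "('n + 'n) set"
    obtain b c where "a = entry_index b c" by (rule entry_index_surj)
    moreover have "entry_index b c \<in> A \<longleftrightarrow> entry_index b c \<in> B"
      using op_of_matrix_entry[of A c b] op_of_matrix_entry[of B c b] unfolding eq
      by (simp only: of_bool_eq_iff)
    ultimately show "a \<in> A \<longleftrightarrow> a \<in> B" by (simp only:)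
  qed
  then show "op_of A = op_of B \<longleftrightarrow> A = B" by auto
next
  fix A :: "('n + 'n) set set"
  show "op_of A \<in> carrier End_algebra"
    by (simp add: op_of_additive)
next
  fix T :: "'n boolfun \<Rightarrow> 'n boolfun"
  assume "T \<in> carrier End_algebra"
  then have T: "T (f + g) = T f + T g" for f g by simp
  \<comment> \<open>the positions at which the matrix of \<open>T\<close> has an entry 1\<close>
  define A where "A = {entry_index b c |b c. T (m_fun c) (indicator_vec b) = 1}"
  have "T = op_of A"
  proof (rule additive_eq_on_m_fun)
    fix b c :: "'n set"
    have "entry_index b c \<in> A \<longleftrightarrow> T (m_fun c) (indicator_vec b) = 1"
      by (auto simp: A_def entry_index_inject)
    then show "T (m_fun c) (indicator_vec b) = op_of A (m_fun c) (indicator_vec b)"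
      by (simp add: op_of_matrix_entry of_bool_def)
  qed (simp_all add: T op_of_additive)
  then show "\<exists>A\<in>UNIV. T = op_of A" by (rule bexI) simp
qed

theorem theorem50:
  shows "\<exists>(star :: ('n::finite + 'n) set set \<Rightarrow> ('n + 'n) set set \<Rightarrow> ('n + 'n) set set)
          (act :: ('n + 'n) set set \<Rightarrow> 'n set set \<Rightarrow> 'n set set)
          (e :: ('n + 'n) set set).
      assoc_algebra Z2 (symdiff_algebra star e) \<and>
      algebra_module_pair Z2 (symdiff_algebra star e) symdiff_space act \<and>
      pair_iso Z2 (symdiff_algebra star e) symdiff_space act
        End_algebra boolfun_algebra (\<lambda>T f. T f) op_of fun_of"
proof -
  have op_add: "op_of ((A \<union> B) - (A \<inter> B)) = op_of A \<oplus>\<^bsub>End_algebra\<^esub> op_of B"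
    for A B :: "('n + 'n) set set"
    unfolding op_of_def End_algebra_simps by (rule sum_sym_diff) (simp_all add: fun_eq_iff)
  have fun_add: "fun_of ((F \<union> G) - (F \<inter> G)) = fun_of F \<oplus>\<^bsub>boolfun_algebra\<^esub> fun_of G"
    for F G :: "'n set set"
    unfolding fun_of_def boolfun_algebra_simps by (rule sum_sym_diff) simp_all
  have fun_bij: "bij_betw fun_of UNIV (carrier (boolfun_algebra :: (bit, 'n boolfun) module))"
    by (simp add: bij_fun_of)
  obtain star e and act :: "('n + 'n) set set \<Rightarrow> 'n set set \<Rightarrow> 'n set set"
    where iso: "pair_iso Z2 (symdiff_algebra star e) symdiff_space act
      End_algebra boolfun_algebra (\<lambda>T f. T f) op_of fun_of"
    by (rule symdiff_pair_iso_transport[where f = op_of and g = fun_of,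
          OF End_pair bij_op_of op_add fun_bij fun_add])
  then interpret pair_iso Z2 "symdiff_algebra star e" symdiff_space act
    End_algebra boolfun_algebra "\<lambda>T f. T f" op_of fun_of .
  show ?thesis
    using iso P1.assoc_algebra_axioms P1.algebra_module_pair_axioms by blast
qed

end
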